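(* Let $\mathcal M\in\mathcal L(\mathcal X)$, let $U,V\subset S$ with $U\neq\emptyset$ and $U\cap V=\emptyset$, and let $\lambda\in\mathbb C$ with $\lambda\neq0$ be in the resolvent set of $\mathcal M_{VV}$. Put $W=U\cup V$. Assume that $\mathcal M_{WW}:\mathcal X\to\mathcal X$ has the spectral decomposition $\mathcal M_{WW}=\lambda(h\otimes\nu)+\mathcal R$, where $\lambda$ is a simple eigenvalue of $\mathcal M_{WW}$, $h\in\mathcal X$ is an eigenfunction for $\lambda$, $\nu\in\mathcal X^*$ is an eigenvector for $\lambda$ of the dual $\mathcal M_{WW}^*$ with $\nu(h)=1$, and the spectrum of $\mathcal R$ lies outside a neighborhood of $\lambda$. Assume also $\nu(\mathcal M_{WU}h)\ne0$. Then $\mathcal M[U,V,\lambda]$ has a spectral gap at the simple eigenvalue $\lambda$.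
   Context: $S$ is a countable set, $A$ a zero-one matrix indexed by $S\times S$, and $X=\{\omega\in\prod_{n\ge0}S:A(\omega_n\omega_{n+1})=1\ \forall n\}$. For $U\subset S$, $\Sigma_U=\{\omega\in X:\omega_0\in U\}$ and $\chi_U$ is its indicator function. $(\mathcal X,\|\cdot\|)$ is a complex Banach space of functions on $X$ such that $f\chi_U\in\mathcal X$ for all $f\in\mathcal X$, $U\subset S$, with $f\mapsto f\chi_U$ bounded. $\mathcal L(\mathcal X)$ is the set of bounded linear operators on $\mathcal X$. For $\mathcal M\in\mathcal L(\mathcal X)$ and $U_1,U_2\subset S$, $\mathcal M_{U_1U_2}f=\chi_{U_1}\mathcal M(\chi_{U_2}f)$. For $\lambda$ in the resolvent set of $\mathcal M_{VV}$, $\mathcal M[U,V,\lambda]=\mathcal M_{UU}+\mathcal M_{UV}(\lambda\mathcal I-\mathcal M_{VV})^{-1}\mathcal M_{VU}\in\mathcal L(\mathcal X)$, $\mathcal I$ the identity. $(h\otimes\nu)f=\nu(f)h$. An operator has a spectral gap at a simple eigenvalue $\lambda$ if $\lambda$ is a simple eigenvalue of the operator and is an isolated point of its spectrum. *)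

theory Defs
  imports "HOL-Analysis.Analysis" "HOL-Library.Function_Algebras"
begin

section \<open>Complex Banach spaces of functions\<close>

text \<open>
  HOL-Analysis has no class of complex normed spaces. A space of complex functions on a set
  \<open>X\<close> is given by a carrier \<open>F\<close> and a norm \<open>N\<close>, whose values off \<open>F\<close> are irrelevant.
  A function on \<open>X\<close> is encoded as a total function vanishing off \<open>X\<close>.
\<close>

definition cscale :: "complex \<Rightarrow> ('x \<Rightarrow> complex) \<Rightarrow> 'x \<Rightarrow> complex" where
  "cscale c f = (\<lambda>x. c * f x)"

global_interpretation cfun: vector_space cscale
  by unfold_locales (auto simp: cscale_def fun_eq_iff algebra_simps)

locale banach_function_space =
  fixes X :: "'x set" and F :: "('x \<Rightarrow> complex) set" and N :: "('x \<Rightarrow> complex) \<Rightarrow> real"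
  assumes subspace: "cfun.subspace F"
    and vanish_outside: "f \<in> F \<Longrightarrow> x \<notin> X \<Longrightarrow> f x = 0"
    and norm_eq_0_iff: "f \<in> F \<Longrightarrow> N f = 0 \<longleftrightarrow> f = 0"
    and norm_cscale: "f \<in> F \<Longrightarrow> N (cscale c f) = cmod c * N f"
    and norm_triangle: "f \<in> F \<Longrightarrow> g \<in> F \<Longrightarrow> N (f + g) \<le> N f + N g"
    and complete: "\<lbrakk>\<forall>n. \<sigma> n \<in> F; \<forall>e>0. \<exists>n0. \<forall>m\<ge>n0. \<forall>n\<ge>n0. N (\<sigma> m - \<sigma> n) < e\<rbrakk>
      \<Longrightarrow> \<exists>f\<in>F. (\<lambda>n. N (\<sigma> n - f)) \<longlonglongrightarrow> 0"

section \<open>Bounded operators and spectral theory\<close>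

text \<open>
  Operators and functionals are total functions on the ambient type; only their restriction
  to \<open>F\<close> is meaningful, and equations between them are required on \<open>F\<close> only.
\<close>

definition bounded_ops ::
    "('x \<Rightarrow> complex) set \<Rightarrow> (('x \<Rightarrow> complex) \<Rightarrow> real) \<Rightarrow> (('x \<Rightarrow> complex) \<Rightarrow> ('x \<Rightarrow> complex)) set" where
  "bounded_ops F N = {T.
     (\<forall>f\<in>F. T f \<in> F) \<and>
     (\<forall>f\<in>F. \<forall>g\<in>F. T (f + g) = T f + T g) \<and>
     (\<forall>c. \<forall>f\<in>F. T (cscale c f) = cscale c (T f)) \<and>
     (\<exists>K. \<forall>f\<in>F. N (T f) \<le> K * N f)}"

definition dual_space ::
    "('x \<Rightarrow> complex) set \<Rightarrow> (('x \<Rightarrow> complex) \<Rightarrow> real) \<Rightarrow> (('x \<Rightarrow> complex) \<Rightarrow> complex) set" where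
  "dual_space F N = {\<nu>.
     (\<forall>f\<in>F. \<forall>g\<in>F. \<nu> (f + g) = \<nu> f + \<nu> g) \<and>
     (\<forall>c. \<forall>f\<in>F. \<nu> (cscale c f) = c * \<nu> f) \<and>
     (\<exists>K. \<forall>f\<in>F. cmod (\<nu> f) \<le> K * N f)}"

definition resolvent_set ::
    "('x \<Rightarrow> complex) set \<Rightarrow> (('x \<Rightarrow> complex) \<Rightarrow> real) \<Rightarrow> (('x \<Rightarrow> complex) \<Rightarrow> ('x \<Rightarrow> complex)) \<Rightarrow> complex set" where
  "resolvent_set F N T = {z. \<exists>B \<in> bounded_ops F N.
     \<forall>f\<in>F. B (cscale z f - T f) = f \<and> cscale z (B f) - T (B f) = f}"

definition spectrum ::
    "('x \<Rightarrow> complex) set \<Rightarrow> (('x \<Rightarrow> complex) \<Rightarrow> real) \<Rightarrow> (('x \<Rightarrow> complex) \<Rightarrow> ('x \<Rightarrow> complex)) \<Rightarrow> complex set" where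
  "spectrum F N T = - resolvent_set F N T"

text \<open>Used only for \<open>z \<in> resolvent_set F N T\<close>.\<close>

definition resolvent ::
    "('x \<Rightarrow> complex) set \<Rightarrow> (('x \<Rightarrow> complex) \<Rightarrow> ('x \<Rightarrow> complex)) \<Rightarrow> complex \<Rightarrow> ('x \<Rightarrow> complex) \<Rightarrow> ('x \<Rightarrow> complex)" where
  "resolvent F T z = inv_into F (\<lambda>f. cscale z f - T f)"

definition eigenvector ::
    "('x \<Rightarrow> complex) set \<Rightarrow> (('x \<Rightarrow> complex) \<Rightarrow> ('x \<Rightarrow> complex)) \<Rightarrow> complex \<Rightarrow> ('x \<Rightarrow> complex) \<Rightarrow> bool" where
  "eigenvector F T z h \<longleftrightarrow> h \<in> F \<and> h \<noteq> 0 \<and> T h = cscale z h"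

definition dual_eigenvector ::
    "('x \<Rightarrow> complex) set \<Rightarrow> (('x \<Rightarrow> complex) \<Rightarrow> real) \<Rightarrow> (('x \<Rightarrow> complex) \<Rightarrow> ('x \<Rightarrow> complex)) \<Rightarrow> complex \<Rightarrow>
     (('x \<Rightarrow> complex) \<Rightarrow> complex) \<Rightarrow> bool" where
  "dual_eigenvector F N T z \<nu> \<longleftrightarrow>
     \<nu> \<in> dual_space F N \<and> (\<exists>f\<in>F. \<nu> f \<noteq> 0) \<and> (\<forall>f\<in>F. \<nu> (T f) = z * \<nu> f)"

definition generalized_eigenspace ::
    "('x \<Rightarrow> complex) set \<Rightarrow> (('x \<Rightarrow> complex) \<Rightarrow> ('x \<Rightarrow> complex)) \<Rightarrow> complex \<Rightarrow> ('x \<Rightarrow> complex) set" where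
  "generalized_eigenspace F T z = {f \<in> F. \<exists>n. ((\<lambda>g. cscale z g - T g) ^^ n) f = 0}"

text \<open>
  Simple means algebraic multiplicity one. Note that \<open>cfun.dim\<close> of an infinite-dimensional
  space is \<open>0\<close>, so the condition below does exclude infinite multiplicity.
\<close>

definition simple_eigenvalue ::
    "('x \<Rightarrow> complex) set \<Rightarrow> (('x \<Rightarrow> complex) \<Rightarrow> ('x \<Rightarrow> complex)) \<Rightarrow> complex \<Rightarrow> bool" where
  "simple_eigenvalue F T z \<longleftrightarrow>
     (\<exists>h. eigenvector F T z h) \<and> cfun.dim (generalized_eigenspace F T z) = 1"

definition spectral_gap_at ::
    "('x \<Rightarrow> complex) set \<Rightarrow> (('x \<Rightarrow> complex) \<Rightarrow> real) \<Rightarrow> (('x \<Rightarrow> complex) \<Rightarrow> ('x \<Rightarrow> complex)) \<Rightarrow> complex \<Rightarrow> bool" where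
  "spectral_gap_at F N T z \<longleftrightarrow> simple_eigenvalue F T z \<and> z isolated_in (spectrum F N T)"

definition rank_one ::
    "('x \<Rightarrow> complex) \<Rightarrow> (('x \<Rightarrow> complex) \<Rightarrow> complex) \<Rightarrow> ('x \<Rightarrow> complex) \<Rightarrow> ('x \<Rightarrow> complex)" where
  "rank_one h \<nu> f = cscale (\<nu> f) h"

section \<open>Markov shifts and generalised Perron complements\<close>

definition markov_shift :: "'s set \<Rightarrow> ('s \<Rightarrow> 's \<Rightarrow> nat) \<Rightarrow> (nat \<Rightarrow> 's) set" where
  "markov_shift S A = {\<omega>. (\<forall>n. \<omega> n \<in> S) \<and> (\<forall>n. A (\<omega> n) (\<omega> (Suc n)) = 1)}"

definition cylinder :: "'s set \<Rightarrow> ('s \<Rightarrow> 's \<Rightarrow> nat) \<Rightarrow> 's set \<Rightarrow> (nat \<Rightarrow> 's) set" where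
  "cylinder S A U = {\<omega> \<in> markov_shift S A. \<omega> 0 \<in> U}"

definition chi :: "'s set \<Rightarrow> ('s \<Rightarrow> 's \<Rightarrow> nat) \<Rightarrow> 's set \<Rightarrow> (nat \<Rightarrow> 's) \<Rightarrow> complex" where
  "chi S A U = indicator (cylinder S A U)"

locale shift_function_space = banach_function_space "markov_shift S A" F N
  for S :: "'s set" and A :: "'s \<Rightarrow> 's \<Rightarrow> nat"
    and F :: "((nat \<Rightarrow> 's) \<Rightarrow> complex) set" and N :: "((nat \<Rightarrow> 's) \<Rightarrow> complex) \<Rightarrow> real" +
  assumes countable_states: "countable S"
    and zero_one: "i \<in> S \<Longrightarrow> j \<in> S \<Longrightarrow> A i j \<in> {0, 1}"
    and chi_mult: "U \<subseteq> S \<Longrightarrow> (\<lambda>f. f * chi S A U) \<in> bounded_ops F N"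

definition block ::
    "'s set \<Rightarrow> ('s \<Rightarrow> 's \<Rightarrow> nat) \<Rightarrow> (((nat \<Rightarrow> 's) \<Rightarrow> complex) \<Rightarrow> ((nat \<Rightarrow> 's) \<Rightarrow> complex)) \<Rightarrow>
     's set \<Rightarrow> 's set \<Rightarrow> ((nat \<Rightarrow> 's) \<Rightarrow> complex) \<Rightarrow> ((nat \<Rightarrow> 's) \<Rightarrow> complex)" where
  "block S A M U1 U2 f = chi S A U1 * M (chi S A U2 * f)"

definition perron_complement ::
    "'s set \<Rightarrow> ('s \<Rightarrow> 's \<Rightarrow> nat) \<Rightarrow> ((nat \<Rightarrow> 's) \<Rightarrow> complex) set \<Rightarrow>
     (((nat \<Rightarrow> 's) \<Rightarrow> complex) \<Rightarrow> ((nat \<Rightarrow> 's) \<Rightarrow> complex)) \<Rightarrow> 's set \<Rightarrow> 's set \<Rightarrow> complex \<Rightarrow>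
     ((nat \<Rightarrow> 's) \<Rightarrow> complex) \<Rightarrow> ((nat \<Rightarrow> 's) \<Rightarrow> complex)" where
  "perron_complement S A F M U V z f =
     block S A M U U f + block S A M U V (resolvent F (block S A M V V) z (block S A M V U f))"

end

theory Submission
  imports Defs
begin

text \<open>
  Write \<open>T\<close> for the operator on \<open>W\<close>, \<open>P\<close> for the complement, and \<open>\<chi>\<close> for multiplication by the
  indicator of \<open>U\<close>. Eliminating the \<open>V\<close>-component shows that \<open>(lam - T) w = u\<close> with \<open>u\<close> supported on
  \<open>U\<close> implies \<open>(lam - P) (\<chi> w) = u\<close>. Hence \<open>k = \<chi> h\<close> is an eigenvector of \<open>P\<close>, and \<open>\<phi> = \<nu> \<circ> \<chi>\<close>,
  normalised by \<open>\<phi> k = 1\<close>, is a dual eigenvector; the normalisation is possible because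
  \<open>lam * \<nu> (\<chi> h) = \<nu> (T (\<chi> h)) \<noteq> 0\<close>. Since \<open>\<nu>\<close> annihilates the range of \<open>R\<close>, the resolvent of \<open>R\<close> at
  \<open>lam\<close> solves \<open>(lam - T) w = u\<close> whenever \<open>\<nu> u = 0\<close>, and this yields the inverse of
  \<open>lam - Q\<close> for \<open>Q = P - lam (k \<otimes> \<phi>)\<close>. The complement \<open>P\<close> is taken at the fixed parameter \<open>lam\<close>, so the
  Schur complement does not give the invertibility of \<open>z - P\<close> for \<open>z \<noteq> lam\<close>; this follows instead from
  the openness of the resolvent set of \<open>Q\<close>.
\<close>

section \<open>Bounded operators on a Banach function space\<close>

context banach_function_space
begin

lemma mem_zero [simp]: "0 \<in> F"
  and mem_add [simp]: "f \<in> F \<Longrightarrow> g \<in> F \<Longrightarrow> f + g \<in> F"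
  and mem_diff [simp]: "f \<in> F \<Longrightarrow> g \<in> F \<Longrightarrow> f - g \<in> F"
  and mem_cscale [simp]: "f \<in> F \<Longrightarrow> cscale c f \<in> F"
  and mem_uminus [simp]: "f \<in> F \<Longrightarrow> - f \<in> F"
  by (rule cfun.subspace_0[OF subspace] cfun.subspace_add[OF subspace] cfun.subspace_diff[OF subspace]
      cfun.subspace_scale[OF subspace] cfun.subspace_neg[OF subspace]; assumption)+

section \<open>Norm estimates and the metric induced by the norm\<close>

lemma norm_zero [simp]: "N 0 = 0"
  using norm_eq_0_iff[of 0] by simp

lemma norm_minus: "f \<in> F \<Longrightarrow> g \<in> F \<Longrightarrow> N (f - g) = N (g - f)"
proof -
  assume "f \<in> F" "g \<in> F"
  moreover have "f - g = cscale (-1) (g - f)"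
    by (simp add: fun_eq_iff cscale_def)
  ultimately show ?thesis
    using norm_cscale[of "g - f" "-1"] by simp
qed

lemma norm_nonneg: "f \<in> F \<Longrightarrow> 0 \<le> N f"
  using norm_triangle[of f "0 - f"] norm_minus[of f 0] by simp

lemma norm_diff_le: "f \<in> F \<Longrightarrow> g \<in> F \<Longrightarrow> N (f - g) \<le> N f + N g"
  using norm_triangle[of f "0 - g"] norm_minus[of g 0] by simp

text \<open>The value 0 off \<open>F\<close> keeps nonnegativity and symmetry true for all
  arguments, as \<open>Metric_space\<close> demands, although \<open>N\<close> is unconstrained
  there.\<close>

definition dist_on :: "('x \<Rightarrow> complex) \<Rightarrow> ('x \<Rightarrow> complex) \<Rightarrow> real" where
  "dist_on f g = (if f \<in> F \<and> g \<in> F then N (f - g) else 0)"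

sublocale norm_dist: Metric_space F dist_on
proof
  show "0 \<le> dist_on f g" for f g
    by (simp add: dist_on_def norm_nonneg)
  show "dist_on f g = dist_on g f" for f g
    by (simp add: dist_on_def norm_minus)
  show "f \<in> F \<Longrightarrow> g \<in> F \<Longrightarrow> dist_on f g = 0 \<longleftrightarrow> f = g" for f g
    by (simp add: dist_on_def norm_eq_0_iff)
  show "f \<in> F \<Longrightarrow> g \<in> F \<Longrightarrow> k \<in> F \<Longrightarrow> dist_on f k \<le> dist_on f g + dist_on g k" for f g k
    using norm_triangle[of "f - g" "g - k"] by (simp add: dist_on_def)
qed

text \<open>Puts the completeness axiom into the form that the Banach fixed point theorem
  takes.\<close>

lemma mcomplete_dist_on: "norm_dist.mcomplete"
  unfolding norm_dist.mcomplete_def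
proof (intro allI impI)
  fix \<sigma> assume \<sigma>: "norm_dist.MCauchy \<sigma>"
  then have F: "\<forall>n. \<sigma> n \<in> F"
    by (auto simp: norm_dist.MCauchy_def)
  moreover from \<sigma> F have "\<forall>e>0. \<exists>n0. \<forall>m\<ge>n0. \<forall>n\<ge>n0. N (\<sigma> m - \<sigma> n) < e"
    unfolding norm_dist.MCauchy_def dist_on_def by auto
  ultimately obtain f where "f \<in> F" "(\<lambda>n. N (\<sigma> n - f)) \<longlonglongrightarrow> 0"
    using complete by blast
  with F show "\<exists>f. limitin norm_dist.mtopology \<sigma> f sequentially"
    by (auto simp: norm_dist.limitin_metric_dist_null dist_on_def)
qed

section \<open>Algebra of bounded operators\<close>

lemma op_mem: "T \<in> bounded_ops F N \<Longrightarrow> f \<in> F \<Longrightarrow> T f \<in> F"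
  and op_add: "T \<in> bounded_ops F N \<Longrightarrow> f \<in> F \<Longrightarrow> g \<in> F \<Longrightarrow> T (f + g) = T f + T g"
  and op_cscale: "T \<in> bounded_ops F N \<Longrightarrow> f \<in> F \<Longrightarrow> T (cscale c f) = cscale c (T f)"
  by (auto simp: bounded_ops_def)

lemma op_diff: "T \<in> bounded_ops F N \<Longrightarrow> f \<in> F \<Longrightarrow> g \<in> F \<Longrightarrow> T (f - g) = T f - T g"
  using op_add[of T "f - g" g] by (simp add: algebra_simps)

lemma op_zero: "T \<in> bounded_ops F N \<Longrightarrow> T 0 = 0"
  using op_diff[of T 0 0] by simp

text \<open>The definition of boundedness allows a constant that is not positive; raising it to at
  least 1 makes it safe to divide by it and to multiply inequalities with it.\<close>

lemma op_bound:
  assumes "T \<in> bounded_ops F N"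
  obtains K where "K > 0" "\<And>f. f \<in> F \<Longrightarrow> N (T f) \<le> K * N f"
proof -
  obtain K where K: "\<And>f. f \<in> F \<Longrightarrow> N (T f) \<le> K * N f"
    using assms unfolding bounded_ops_def by blast
  have "N (T f) \<le> max K 1 * N f" if "f \<in> F" for f
    using K[OF that] mult_right_mono[of K "max K 1" "N f"] norm_nonneg[OF that] by linarith
  with that[of "max K 1"] show ?thesis by simp
qed

lemma bounded_opsI:
  assumes "\<And>f. f \<in> F \<Longrightarrow> T f \<in> F"
    and "\<And>f g. f \<in> F \<Longrightarrow> g \<in> F \<Longrightarrow> T (f + g) = T f + T g"
    and "\<And>c f. f \<in> F \<Longrightarrow> T (cscale c f) = cscale c (T f)"
    and "\<And>f. f \<in> F \<Longrightarrow> N (T f) \<le> K * N f"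
  shows "T \<in> bounded_ops F N"
  unfolding bounded_ops_def using assms by blast

lemma bounded_ops_add:
  assumes S: "S \<in> bounded_ops F N" and T: "T \<in> bounded_ops F N"
  shows "(\<lambda>f. S f + T f) \<in> bounded_ops F N"
proof -
  obtain K where K: "\<And>f. f \<in> F \<Longrightarrow> N (S f) \<le> K * N f"
    using op_bound[OF S] by blast
  obtain L where L: "\<And>f. f \<in> F \<Longrightarrow> N (T f) \<le> L * N f"
    using op_bound[OF T] by blast
  have bound: "N (S f + T f) \<le> (K + L) * N f" if "f \<in> F" for f
    using norm_triangle[OF op_mem[OF S that] op_mem[OF T that]] K[OF that] L[OF that]
    by (simp add: distrib_right)
  show ?thesis
    by (rule bounded_opsI[OF _ _ _ bound]) (simp_all add: op_mem[OF S] op_mem[OF T] op_add[OF S] op_add[OF T]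
        op_cscale[OF S] op_cscale[OF T] cfun.scale_right_distrib add_ac)
qed

lemma bounded_ops_compose:
  assumes S: "S \<in> bounded_ops F N" and T: "T \<in> bounded_ops F N"
  shows "(\<lambda>f. S (T f)) \<in> bounded_ops F N"
proof -
  obtain K where K: "K > 0" "\<And>f. f \<in> F \<Longrightarrow> N (S f) \<le> K * N f"
    using op_bound[OF S] by blast
  obtain L where L: "\<And>f. f \<in> F \<Longrightarrow> N (T f) \<le> L * N f"
    using op_bound[OF T] by blast
  have bound: "N (S (T f)) \<le> (K * L) * N f" if "f \<in> F" for f
    using order_trans[OF K(2)[OF op_mem[OF T that]] mult_left_mono[OF L[OF that], of K]] K(1)
    by (simp add: mult.assoc)
  show ?thesis
    by (rule bounded_opsI[OF _ _ _ bound]) (simp_all add: op_mem[OF S] op_mem[OF T] op_add[OF S] op_add[OF T]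
        op_cscale[OF S] op_cscale[OF T])
qed

lemma bounded_ops_cscale: "cscale c \<in> bounded_ops F N"
  by (rule bounded_opsI[where K = "cmod c"])
    (simp_all add: norm_cscale cfun.scale_right_distrib mult.commute)

lemma bounded_ops_id: "(\<lambda>f. f) \<in> bounded_ops F N"
  by (rule bounded_opsI[where K = 1]) simp_all

lemma bounded_ops_diff:
  assumes S: "S \<in> bounded_ops F N" and T: "T \<in> bounded_ops F N"
  shows "(\<lambda>f. S f - T f) \<in> bounded_ops F N"
proof -
  have "(\<lambda>f. S f + cscale (-1) (T f)) \<in> bounded_ops F N"
    by (intro bounded_ops_add bounded_ops_compose[OF bounded_ops_cscale] S T)
  moreover have "(\<lambda>f. S f + cscale (-1) (T f)) = (\<lambda>f. S f - T f)"
    by (simp add: fun_eq_iff cscale_def)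
  ultimately show ?thesis by simp
qed

section \<open>Bounded functionals and rank-one operators\<close>

lemma dual_add: "\<phi> \<in> dual_space F N \<Longrightarrow> f \<in> F \<Longrightarrow> g \<in> F \<Longrightarrow> \<phi> (f + g) = \<phi> f + \<phi> g"
  and dual_cscale: "\<phi> \<in> dual_space F N \<Longrightarrow> f \<in> F \<Longrightarrow> \<phi> (cscale c f) = c * \<phi> f"
  by (auto simp: dual_space_def)

lemma dual_diff: "\<phi> \<in> dual_space F N \<Longrightarrow> f \<in> F \<Longrightarrow> g \<in> F \<Longrightarrow> \<phi> (f - g) = \<phi> f - \<phi> g"
  using dual_add[of \<phi> "f - g" g] by (simp add: algebra_simps)

lemma dual_spaceI:
  assumes "\<And>f g. f \<in> F \<Longrightarrow> g \<in> F \<Longrightarrow> \<phi> (f + g) = \<phi> f + \<phi> g"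
    and "\<And>c f. f \<in> F \<Longrightarrow> \<phi> (cscale c f) = c * \<phi> f"
    and "\<And>f. f \<in> F \<Longrightarrow> cmod (\<phi> f) \<le> K * N f"
  shows "\<phi> \<in> dual_space F N"
  unfolding dual_space_def using assms by blast

lemma dual_compose:
  assumes \<phi>: "\<phi> \<in> dual_space F N" and T: "T \<in> bounded_ops F N"
  shows "(\<lambda>f. \<phi> (T f) / c) \<in> dual_space F N"
proof -
  obtain K where K: "\<And>f. f \<in> F \<Longrightarrow> cmod (\<phi> f) \<le> K * N f"
    using \<phi> unfolding dual_space_def by blast
  obtain L where L: "\<And>f. f \<in> F \<Longrightarrow> N (T f) \<le> L * N f"
    using op_bound[OF T] by blast
  \<comment> \<open>\<open>K\<close> may be negative, while inserting the bound for
    \<open>N (T f)\<close> needs a nonnegative factor; hence the absolute value.\<close>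
  have bound: "cmod (\<phi> (T f) / c) \<le> (\<bar>K\<bar> * L / cmod c) * N f" if "f \<in> F" for f
  proof -
    have "cmod (\<phi> (T f)) \<le> K * N (T f)"
      using K op_mem[OF T that] by simp
    also have "\<dots> \<le> \<bar>K\<bar> * N (T f)"
      using norm_nonneg[OF op_mem[OF T that]] by (simp add: mult_right_mono)
    also have "\<dots> \<le> \<bar>K\<bar> * (L * N f)"
      using L[OF that] by (simp add: mult_left_mono)
    finally show ?thesis
      by (simp add: norm_divide divide_right_mono mult.assoc)
  qed
  show ?thesis
    by (rule dual_spaceI[OF _ _ bound]) (simp_all add: op_add[OF T] op_cscale[OF T] dual_add[OF \<phi>] dual_cscale[OF \<phi>]
        op_mem[OF T] add_divide_distrib)
qed

lemma bounded_ops_rank_one: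
  assumes \<phi>: "\<phi> \<in> dual_space F N" and k: "k \<in> F"
  shows "rank_one k \<phi> \<in> bounded_ops F N"
proof -
  obtain K where K: "\<And>f. f \<in> F \<Longrightarrow> cmod (\<phi> f) \<le> K * N f"
    using \<phi> unfolding dual_space_def by blast
  have bound: "N (rank_one k \<phi> f) \<le> (K * N k) * N f" if "f \<in> F" for f
    using mult_right_mono[OF K[OF that] norm_nonneg[OF k]] by (simp add: rank_one_def norm_cscale k mult_ac)
  show ?thesis
    by (rule bounded_opsI[OF _ _ _ bound]) (simp_all add: rank_one_def k dual_add[OF \<phi>] dual_cscale[OF \<phi>]
        cfun.scale_left_distrib)
qed

subsection \<open>Resolvents and isolated eigenvalues\<close>

text \<open>The lower bound on \<open>z - T\<close> yields both injectivity and the bound for the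
  inverse, so no open mapping argument is involved. Linearity of the inverse follows by comparing
  images under \<open>z - T\<close>.\<close>

lemma resolvent_setI:
  assumes T: "T \<in> bounded_ops F N"
    and surj: "\<And>u. u \<in> F \<Longrightarrow> \<exists>f\<in>F. cscale z f - T f = u"
    and bound: "\<And>f. f \<in> F \<Longrightarrow> N f \<le> K * N (cscale z f - T f)"
  shows "z \<in> resolvent_set F N T"
proof -
  define D where "D f = cscale z f - T f" for f
  have D: "D \<in> bounded_ops F N"
    unfolding D_def by (intro bounded_ops_diff bounded_ops_cscale T)
  have inj: "f = g" if "f \<in> F" "g \<in> F" "D f = D g" for f g
  proof -
    have "N (f - g) \<le> 0"
      using bound[of "f - g"] op_diff[OF D that(1,2)] that by (simp flip: D_def)
    then show ?thesis
      using norm_eq_0_iff[of "f - g"] norm_nonneg[of "f - g"] that by simp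
  qed
  define E where "E = inv_into F D"
  have img: "u \<in> D ` F" if "u \<in> F" for u
    using surj[OF that] by (auto simp: D_def)
  have E: "E u \<in> F" "D (E u) = u" if "u \<in> F" for u
    unfolding E_def using inv_into_into[OF img[OF that]] f_inv_into_f[OF img[OF that]] by simp_all
  have "E \<in> bounded_ops F N"
  proof (rule bounded_opsI)
    show "E (f + g) = E f + E g" if "f \<in> F" "g \<in> F" for f g
      using that by - (rule inj; simp add: E op_add[OF D])
    show "E (cscale c f) = cscale c (E f)" if "f \<in> F" for c f
      using that by - (rule inj; simp add: E op_cscale[OF D])
    show "N (E f) \<le> K * N f" if "f \<in> F" for f
      using bound[OF E(1)[OF that]] E(2)[OF that] by (simp add: D_def)
  qed (rule E)
  moreover have "E (D f) = f" if "f \<in> F" for f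
    using that by - (rule inj; simp add: E op_mem[OF D])
  ultimately show ?thesis
    using E(2) unfolding resolvent_set_def D_def by blast
qed

text \<open>The equation \<open>(z - T) f = u\<close> is the fixed point equation \<open>f = B (u - (z - z0) f)\<close>,
  where \<open>B\<close> inverts \<open>z0 - T\<close>; the right-hand side is a contraction for \<open>z\<close> near \<open>z0\<close>.\<close>

lemma open_resolvent_set:
  assumes T: "T \<in> bounded_ops F N"
  shows "open (resolvent_set F N T)"
  unfolding open_dist
proof
  fix z0 assume "z0 \<in> resolvent_set F N T"
  then obtain B where B: "B \<in> bounded_ops F N"
    and BL: "\<And>f. f \<in> F \<Longrightarrow> B (cscale z0 f - T f) = f"
    and BR: "\<And>f. f \<in> F \<Longrightarrow> cscale z0 (B f) - T (B f) = f"
    unfolding resolvent_set_def by blast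
  obtain K where K: "K > 0" "\<And>f. f \<in> F \<Longrightarrow> N (B f) \<le> K * N f"
    using op_bound[OF B] by blast
  show "\<exists>e>0. \<forall>z. dist z z0 < e \<longrightarrow> z \<in> resolvent_set F N T"
  proof (intro exI conjI allI impI)
    \<comment> \<open>This radius gives the fixed point map the contraction factor 1/2.\<close>
    show "1 / (2 * K) > 0" using K by simp
    fix z assume "dist z z0 < 1 / (2 * K)"
    then have small: "K * cmod (z - z0) \<le> 1 / 2"
      using K by (simp add: dist_norm field_simps)
    define c where "c = z - z0"
    have contr: "N (B (cscale c f)) \<le> 1 / 2 * N f" if "f \<in> F" for f
    proof -
      have "N (B (cscale c f)) \<le> (K * cmod c) * N f"
        using K(2)[of "cscale c f"] that by (simp add: norm_cscale mult.assoc)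
      also have "\<dots> \<le> 1 / 2 * N f"
        using small norm_nonneg[OF that] unfolding c_def by (rule mult_right_mono)
      finally show ?thesis .
    qed
    have Dz: "cscale z f - T f = (cscale z0 f - T f) + cscale c f" for f
      by (simp add: fun_eq_iff cscale_def c_def algebra_simps)
    show "z \<in> resolvent_set F N T"
    proof (rule resolvent_setI[OF T])
      fix u assume u: "u \<in> F"
      obtain f where f: "f \<in> F" "B (u - cscale c f) = f"
      proof (rule norm_dist.Banach_fixedpoint_thm[of "\<lambda>f. B (u - cscale c f)" "1 / 2"])
        show "norm_dist.mcomplete" by (rule mcomplete_dist_on)
        show "(\<lambda>f. B (u - cscale c f)) \<in> F \<rightarrow> F"
          using u by (simp add: op_mem[OF B])
        fix f g assume fg: "f \<in> F" "g \<in> F"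
        have "B (u - cscale c f) - B (u - cscale c g) = B (cscale c (g - f))"
          using u fg by (simp add: op_diff[OF B] cfun.scale_right_diff_distrib)
        then show "dist_on (B (u - cscale c f)) (B (u - cscale c g)) \<le> 1 / 2 * dist_on f g"
          using contr[of "g - f"] u fg norm_minus[of f g] by (simp add: dist_on_def op_mem[OF B])
      qed (use mem_zero in fastforce)+
      then show "\<exists>f\<in>F. cscale z f - T f = u"
        using BR[of "u - cscale c f"] u by (intro bexI[of _ f]) (simp_all add: Dz)
    next
      fix f assume f: "f \<in> F"
      define u where "u = cscale z f - T f"
      have u: "u \<in> F" using f op_mem[OF T] by (simp add: u_def)
      have "f = B (u - cscale c f)"
        using BL[OF f] by (simp add: u_def Dz)
      also have "\<dots> = B u - B (cscale c f)"
        using u f by (simp add: op_diff[OF B])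
      \<comment> \<open>The last term is at most half of \<open>N f\<close>; absorbing it on the
        left gives the constant \<open>2 * K\<close>.\<close>
      finally have "N f \<le> N (B u) + N (B (cscale c f))"
        using norm_diff_le[of "B u" "B (cscale c f)"] u f by (simp add: op_mem[OF B])
      then show "N f \<le> (2 * K) * N (cscale z f - T f)"
        using K(2)[OF u] contr[OF f] by (simp flip: u_def)
    qed
  qed
qed

text \<open>For a right inverse \<open>B\<close>, the difference \<open>B ((z - T) f) - f\<close>
  lies in the kernel of \<open>z - T\<close>; a trivial kernel makes \<open>B\<close>
  two-sided.\<close>

lemma bounded_right_inverse_imp_resolvent_set:
  assumes T: "T \<in> bounded_ops F N" and B: "B \<in> bounded_ops F N"
    and right: "\<And>u. u \<in> F \<Longrightarrow> cscale z (B u) - T (B u) = u"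
    and ker: "\<And>f. f \<in> F \<Longrightarrow> T f = cscale z f \<Longrightarrow> f = 0"
  shows "z \<in> resolvent_set F N T"
proof -
  have D: "(\<lambda>f. cscale z f - T f) \<in> bounded_ops F N"
    by (intro bounded_ops_diff bounded_ops_cscale T)
  have "B (cscale z f - T f) = f" if f: "f \<in> F" for f
  proof -
    let ?g = "B (cscale z f - T f)"
    have g: "?g \<in> F" using f by (simp add: op_mem[OF B] op_mem[OF T])
    have "cscale z ?g - T ?g = cscale z f - T f"
      using f by (intro right) (simp add: op_mem[OF T])
    then have "cscale z (?g - f) - T (?g - f) = 0"
      using op_diff[OF D g f] by simp
    then have "?g - f = 0"
      using f g by (intro ker) simp_all
    then show ?thesis by simp
  qed
  then show ?thesis
    unfolding resolvent_set_def using B right by blast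
qed

text \<open>Since \<open>z - T\<close> is injective on \<open>F\<close>, the choice made by
  \<open>inv_into\<close> is forced and agrees on \<open>F\<close> with the bounded inverse
  \<open>B\<close>.\<close>

lemma
  assumes z: "z \<in> resolvent_set F N T"
  shows resolvent_op: "resolvent F T z \<in> bounded_ops F N"
    and resolvent_left: "f \<in> F \<Longrightarrow> resolvent F T z (cscale z f - T f) = f"
    and resolvent_right: "f \<in> F \<Longrightarrow> cscale z (resolvent F T z f) - T (resolvent F T z f) = f"
proof -
  obtain B where B: "B \<in> bounded_ops F N"
    and BL: "\<And>f. f \<in> F \<Longrightarrow> B (cscale z f - T f) = f"
    and BR: "\<And>f. f \<in> F \<Longrightarrow> cscale z (B f) - T (B f) = f"
    using z unfolding resolvent_set_def by blast
  have inj: "inj_on (\<lambda>f. cscale z f - T f) F"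
    by (rule inj_on_inverseI[where g = B]) (rule BL)
  have eq: "resolvent F T z f = B f" if "f \<in> F" for f
    using inv_into_f_f[OF inj op_mem[OF B that]] by (simp add: resolvent_def BR[OF that])
  obtain K where K: "\<And>f. f \<in> F \<Longrightarrow> N (B f) \<le> K * N f"
    using op_bound[OF B] by blast
  show "resolvent F T z \<in> bounded_ops F N"
    by (rule bounded_opsI[where K = K]) (simp_all add: eq K op_mem[OF B] op_add[OF B] op_cscale[OF B])
  show "f \<in> F \<Longrightarrow> resolvent F T z (cscale z f - T f) = f"
    using inv_into_f_f[OF inj] by (simp add: resolvent_def)
  show "f \<in> F \<Longrightarrow> cscale z (resolvent F T z f) - T (resolvent F T z f) = f"
    by (simp add: eq BR)
qed

text \<open>\<open>\<phi>\<close> rules out Jordan chains: it vanishes on the range of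
  \<open>z - T\<close> but not at \<open>k\<close>, so \<open>(z - T) f = c k\<close> forces
  \<open>c = 0\<close>.\<close>

lemma simple_eigenvalueI:
  assumes T: "T \<in> bounded_ops F N" and k: "eigenvector F T z k"
    and ker: "\<And>f. f \<in> F \<Longrightarrow> T f = cscale z f \<Longrightarrow> \<exists>c. f = cscale c k"
    and \<phi>: "\<phi> \<in> dual_space F N" "\<phi> k \<noteq> 0" "\<And>f. f \<in> F \<Longrightarrow> \<phi> (T f) = z * \<phi> f"
  shows "simple_eigenvalue F T z"
proof -
  define D where "D f = cscale z f - T f" for f
  have kF: "k \<in> F" and k0: "k \<noteq> 0" and Dk: "D k = 0"
    using k by (auto simp: eigenvector_def D_def)
  have D: "D \<in> bounded_ops F N"
    unfolding D_def by (intro bounded_ops_diff bounded_ops_cscale T)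
  have \<phi>D: "\<phi> (D f) = 0" if "f \<in> F" for f
    using that by (simp add: D_def dual_diff[OF \<phi>(1)] dual_cscale[OF \<phi>(1)] op_mem[OF T] \<phi>(3))
  have kerD: "f \<in> range (\<lambda>c. cscale c k)" if "f \<in> F" "D f = 0" for f
    using ker[of f] that by (auto simp: D_def)
  have pow: "f \<in> range (\<lambda>c. cscale c k)" if "f \<in> F" "(D ^^ n) f = 0" for f n
    using that
  proof (induction n arbitrary: f)
    case 0
    then show ?case using cfun.scale_zero_left[of k] by (metis funpow_0 range_eqI)
  next
    case (Suc n)
    then have "D f \<in> range (\<lambda>c. cscale c k)"
      by (intro Suc.IH) (simp_all add: op_mem[OF D] funpow_swap1)
    then obtain c where c: "D f = cscale c k" by blast
    then have "c = 0"
      using \<phi>D[OF Suc.prems(1)] \<phi>(2) by (simp add: dual_cscale[OF \<phi>(1) kF])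
    then show ?case using c Suc.prems(1) kerD by simp
  qed
  have "generalized_eigenspace F T z = range (\<lambda>c. cscale c k)"
    unfolding generalized_eigenspace_def D_def[symmetric, abs_def]
  proof (intro equalityI subsetI)
    fix f assume "f \<in> range (\<lambda>c. cscale c k)"
    then obtain c where f: "f = cscale c k" by blast
    then have "f \<in> F" and "(D ^^ 1) f = 0"
      using kF Dk by (simp_all add: op_cscale[OF D kF])
    then show "f \<in> {f \<in> F. \<exists>n. (D ^^ n) f = 0}" by blast
  qed (use pow in blast)
  also have "\<dots> = cfun.span {k}"
    by (simp add: cfun.span_singleton)
  finally have "cfun.dim (generalized_eigenspace F T z) = card {k}"
    using k0 by (simp add: cfun.dim_eq_card_independent)
  then show ?thesis
    using k by (auto simp: simple_eigenvalue_def)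
qed

text \<open>If \<open>z\<close> lies in the resolvent set of the deflated operator \<open>Q = T - lam (k \<otimes> \<phi>)\<close>, which is
  invertible near \<open>lam\<close>, then \<open>(z - T)\<inverse> = (z - Q)\<inverse> + lam / (z (z - lam)) (k \<otimes> \<phi>)\<close>.\<close>

lemma spectral_gap_at_if_deflation:
  assumes T: "T \<in> bounded_ops F N" and k: "eigenvector F T lam k" and "lam \<noteq> 0"
    and \<phi>: "\<phi> \<in> dual_space F N" "\<phi> k = 1" "\<And>f. f \<in> F \<Longrightarrow> \<phi> (T f) = lam * \<phi> f"
    and res: "lam \<in> resolvent_set F N (\<lambda>f. T f - cscale lam (rank_one k \<phi> f))"
  shows "spectral_gap_at F N T lam"
proof -
  define Q where "Q f = T f - cscale lam (rank_one k \<phi> f)" for f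
  have kF: "k \<in> F" and k0: "k \<noteq> 0" and Tk: "T k = cscale lam k"
    using k by (auto simp: eigenvector_def)
  have Q: "Q \<in> bounded_ops F N"
    unfolding Q_def
    by (intro bounded_ops_diff bounded_ops_compose[OF bounded_ops_cscale] bounded_ops_rank_one T \<phi> kF)
  have lam_Q: "lam \<in> resolvent_set F N Q"
    using res by (simp add: Q_def[abs_def])
  have Qk: "Q k = 0"
    by (simp add: Q_def rank_one_def \<phi>(2) Tk)
  have \<phi>Q: "\<phi> (Q f) = 0" if "f \<in> F" for f
    using that by (simp add: Q_def rank_one_def dual_diff[OF \<phi>(1)] dual_cscale[OF \<phi>(1)] op_mem[OF T] \<phi> kF)
  have simple: "simple_eigenvalue F T lam"
  proof (rule simple_eigenvalueI[OF T k _ \<phi>(1)])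
    fix f assume f: "f \<in> F" "T f = cscale lam f"
    obtain B where B: "B \<in> bounded_ops F N" "\<And>f. f \<in> F \<Longrightarrow> B (cscale lam f - Q f) = f"
      using lam_Q unfolding resolvent_set_def by blast
    have "f = B (cscale lam f - Q f)"
      using B(2)[OF f(1)] by simp
    \<comment> \<open>Both sides equal \<open>lam * \<phi> f\<close> times \<open>k\<close>, so
      inverting \<open>lam - Q\<close> identifies \<open>f\<close> as a multiple of
      \<open>k\<close>.\<close>
    also have "cscale lam f - Q f = cscale (\<phi> f) (cscale lam k - Q k)"
      unfolding Qk using f(2) by (simp add: Q_def rank_one_def fun_eq_iff cscale_def)
    also have "B \<dots> = cscale (\<phi> f) k"
      using B kF Qk by (metis op_cscale mem_cscale mem_diff mem_zero)
    finally show "\<exists>c. f = cscale c k" by blast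
  qed (use \<phi> in auto)
  have lam_spec: "lam \<in> spectrum F N T"
  proof -
    have "lam \<notin> resolvent_set F N T"
    proof
      assume "lam \<in> resolvent_set F N T"
      then obtain B where B: "B \<in> bounded_ops F N" "B (cscale lam k - T k) = k"
        using kF unfolding resolvent_set_def by blast
      then show False
        using k0 B(2) unfolding Tk diff_self op_zero[OF B(1)] by simp
    qed
    then show ?thesis by (simp add: spectrum_def)
  qed
  have "z \<in> resolvent_set F N T" if z: "z \<in> resolvent_set F N Q" "z \<noteq> 0" "z \<noteq> lam" for z
  proof -
    obtain B where B: "B \<in> bounded_ops F N"
      and BL: "\<And>f. f \<in> F \<Longrightarrow> B (cscale z f - Q f) = f"
      and BR: "\<And>f. f \<in> F \<Longrightarrow> cscale z (B f) - Q (B f) = f"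
      using z(1) unfolding resolvent_set_def by blast
    \<comment> \<open>On \<open>k\<close> the inverse of \<open>z - Q\<close> is
      \<open>1 / z\<close>, whereas that of \<open>z - T\<close> must be
      \<open>1 / (z - lam)\<close>; \<open>a\<close> is the difference.\<close>
    define a where "a = lam / (z * (z - lam))"
    define E where "E u = B u + cscale a (rank_one k \<phi> u)" for u
    have E: "E \<in> bounded_ops F N"
      unfolding E_def
      by (intro bounded_ops_add bounded_ops_compose[OF bounded_ops_cscale] bounded_ops_rank_one B \<phi> kF)
    have \<phi>B: "z * \<phi> (B u) = \<phi> u" if u: "u \<in> F" for u
    proof -
      have "\<phi> u = \<phi> (cscale z (B u) - Q (B u))"
        using BR[OF u] by simp
      then show ?thesis
        using u by (simp add: dual_diff[OF \<phi>(1)] dual_cscale[OF \<phi>(1)] op_mem[OF B] op_mem[OF Q] \<phi>Q)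
    qed
    show ?thesis
    proof (rule bounded_right_inverse_imp_resolvent_set[OF T E])
      fix u assume u: "u \<in> F"
      have "T (E u) = T (B u) + cscale (a * \<phi> u * lam) k"
        using u by (simp add: E_def rank_one_def op_add[OF T] op_cscale[OF T] op_mem[OF B] kF Tk)
      moreover have "T (B u) = Q (B u) + cscale (lam * (\<phi> u / z)) k"
        using \<phi>B[OF u, symmetric] z by (simp add: Q_def rank_one_def)
      moreover have "Q (B u) = cscale z (B u) - u"
        using BR[OF u] by (simp add: algebra_simps)
      moreover have "z * (a * \<phi> u) = lam * (\<phi> u / z) + a * \<phi> u * lam"
        using z by (simp add: a_def field_simps)
      then have "cscale z (cscale (a * \<phi> u) k) = cscale (lam * (\<phi> u / z)) k + cscale (a * \<phi> u * lam) k"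
        by (simp flip: cfun.scale_left_distrib)
      ultimately show "cscale z (E u) - T (E u) = u"
        by (simp add: E_def rank_one_def cfun.scale_right_distrib)
    next
      fix f assume f: "f \<in> F" "T f = cscale z f"
      have "lam * \<phi> f = z * \<phi> f"
        using \<phi>(3)[OF f(1)] unfolding f(2) dual_cscale[OF \<phi>(1) f(1)] by (rule sym)
      then have "\<phi> f = 0" using z by simp
      then have "cscale z f - Q f = 0"
        using f(2) by (simp add: Q_def rank_one_def)
      then show "f = 0"
        using BL[OF f(1)] op_zero[OF B] by simp
    qed
  qed
  \<comment> \<open>As \<open>lam\<close> is nonzero, deleting 0, where the formula for
    \<open>a\<close> breaks down, still leaves an open neighbourhood of \<open>lam\<close>.\<close>
  then have "(resolvent_set F N Q - {0}) \<inter> spectrum F N T = {lam}"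
    using lam_spec lam_Q \<open>lam \<noteq> 0\<close> by (auto simp: spectrum_def)
  moreover have "open (resolvent_set F N Q - {0})"
    by (intro open_Diff open_resolvent_set Q) simp
  ultimately show ?thesis
    unfolding spectral_gap_at_def isolated_in_def using simple lam_spec by blast
qed

end

section \<open>Perron complements\<close>

lemma chi_idem [simp]: "chi S A U * (chi S A U * f) = chi S A U * f"
  by (auto simp: fun_eq_iff chi_def indicator_def)

lemma chi_disjoint: "U \<inter> V = {} \<Longrightarrow> chi S A U * (chi S A V * f) = 0"
  by (auto simp: fun_eq_iff chi_def cylinder_def indicator_def)

lemma chi_Un: "U \<inter> V = {} \<Longrightarrow> chi S A (U \<union> V) = chi S A U + chi S A V"
  by (auto simp: fun_eq_iff chi_def cylinder_def indicator_def)

lemma mult_cscale: "p * cscale c f = cscale c (p * f)"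
  by (simp add: fun_eq_iff cscale_def)

lemma (in shift_function_space) chi_op:
  assumes "U \<subseteq> S"
  shows "(\<lambda>f. chi S A U * f) \<in> bounded_ops F N"
  using chi_mult[OF assms] by (simp add: mult.commute)

lemma (in shift_function_space) block_op:
  assumes "M \<in> bounded_ops F N" "U1 \<subseteq> S" "U2 \<subseteq> S"
  shows "block S A M U1 U2 \<in> bounded_ops F N"
  unfolding block_def[abs_def]
  by (rule bounded_ops_compose[OF chi_op bounded_ops_compose[OF _ chi_op]]) (use assms in auto)

text \<open>The decomposition data \<open>R\<close>, \<open>h\<close>, \<open>\<nu>\<close> stay
  outside: passing between \<open>T\<close> and \<open>P\<close> is pure block elimination.\<close>

locale perron_setting = shift_function_space S A F N
  for S :: "'s set" and A :: "'s \<Rightarrow> 's \<Rightarrow> nat"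
    and F :: "((nat \<Rightarrow> 's) \<Rightarrow> complex) set" and N :: "((nat \<Rightarrow> 's) \<Rightarrow> complex) \<Rightarrow> real" +
  fixes M :: "((nat \<Rightarrow> 's) \<Rightarrow> complex) \<Rightarrow> ((nat \<Rightarrow> 's) \<Rightarrow> complex)"
    and U V :: "'s set" and lam :: complex
  assumes M: "M \<in> bounded_ops F N"
    and U: "U \<subseteq> S" and V: "V \<subseteq> S" and disjoint: "U \<inter> V = {}"
    and lam_nonzero: "lam \<noteq> 0"
    and lam_resolvent: "lam \<in> resolvent_set F N (block S A M V V)"
begin

abbreviation "cU \<equiv> chi S A U"
abbreviation "cV \<equiv> chi S A V"
abbreviation "T \<equiv> block S A M (U \<union> V) (U \<union> V)"
abbreviation "P \<equiv> perron_complement S A F M U V lam"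
abbreviation "G \<equiv> resolvent F (block S A M V V) lam"

lemmas chiU_mem = op_mem[OF chi_op[OF U]] and chiV_mem = op_mem[OF chi_op[OF V]]
lemmas blocks = block_op[OF M U U] block_op[OF M U V] block_op[OF M V U] block_op[OF M V V]
lemmas blocks_mem = blocks[THEN op_mem]
lemmas G_op = resolvent_op[OF lam_resolvent]

lemma disjoint': "V \<inter> U = {}"
  using disjoint by blast

section \<open>Block calculus and the passage between \<open>T\<close> and \<open>P\<close>\<close>

lemma chi_block [simp]: "chi S A U1 * block S A M U1 U2 f = block S A M U1 U2 f"
  by (simp add: block_def)

lemma block_chi [simp]: "block S A M U1 U2 (chi S A U2 * f) = block S A M U1 U2 f"
  by (simp add: block_def)

lemma chi_block_disjoint: "U1 \<inter> U3 = {} \<Longrightarrow> chi S A U1 * block S A M U3 U2 f = 0"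
  by (simp add: block_def chi_disjoint)

lemma block_chi_disjoint: "U2 \<inter> U3 = {} \<Longrightarrow> block S A M U1 U2 (chi S A U3 * f) = 0"
  by (simp add: block_def chi_disjoint op_zero[OF M])

lemmas chi_block_disjoints = chi_block_disjoint[OF disjoint] chi_block_disjoint[OF disjoint']

lemma P_op: "P \<in> bounded_ops F N"
  unfolding perron_complement_def[abs_def]
  by (rule bounded_ops_add[OF blocks(1)
        bounded_ops_compose[OF blocks(2) bounded_ops_compose[OF G_op blocks(3)]]])

lemma chiU_P [simp]: "cU * P f = P f"
  by (simp add: perron_complement_def distrib_left)

lemma P_chiU [simp]: "P (cU * f) = P f"
  by (simp add: perron_complement_def)

lemma T_eq:
  assumes "f \<in> F"
  shows "T f = block S A M U U f + block S A M U V f + (block S A M V U f + block S A M V V f)"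
  using op_add[OF M chiU_mem[OF assms] chiV_mem[OF assms]]
  by (simp add: block_def chi_Un[OF disjoint] algebra_simps)

lemma chi_T:
  assumes "f \<in> F"
  shows "cU * T f = block S A M U U f + block S A M U V f"
    and "cV * T f = block S A M V U f + block S A M V V f"
  by (simp_all add: T_eq[OF assms] distrib_left chi_block_disjoints)

text \<open>Because \<open>u\<close> has no \<open>V\<close>-part, the \<open>V\<close>-part of the
  equation says that \<open>lam - M_VV\<close> maps \<open>cV * w\<close> to \<open>M_VU w\<close>.
  Thus \<open>G\<close> recovers \<open>cV * w\<close>, and \<open>P w\<close> collapses to
  \<open>cU * T w\<close>.\<close>

lemma perron_restrict:
  assumes w: "w \<in> F" and u: "u \<in> F" "cU * u = u" and eq: "cscale lam w - T w = u"
  shows "P w = cscale lam (cU * w) - u"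
proof -
  have Tw: "T w = cscale lam w - u"
    using eq by (simp add: algebra_simps)
  have "cV * u = 0"
    using chi_disjoint[OF disjoint', of S A u] u(2) by simp
  then have "cscale lam (cV * w) = block S A M V U w + block S A M V V w"
    using chi_T(2)[OF w] unfolding Tw by (simp add: right_diff_distrib mult_cscale)
  then have "cscale lam (cV * w) - block S A M V V (cV * w) = block S A M V U w"
    by simp
  then have "G (block S A M V U w) = cV * w"
    using resolvent_left[OF lam_resolvent chiV_mem[OF w]] by simp
  then have "P w = cU * T w"
    by (simp add: perron_complement_def chi_T(1)[OF w])
  then show ?thesis
    unfolding Tw using u(2) by (simp add: right_diff_distrib mult_cscale)
qed

text \<open>Converse direction: \<open>g\<close> is the \<open>V\<close>-component that the
  resolvent prescribes, chosen so that the \<open>V\<close>-part of the image is \<open>lam\<close>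
  times \<open>g\<close> and the \<open>U\<close>-part is \<open>P f\<close>.\<close>

lemma perron_lift:
  assumes f: "f \<in> F"
  obtains g where "g \<in> F" "cV * g = g" "T (cU * f + g) = P f + cscale lam g"
proof
  define g where "g = G (block S A M V U f)"
  show g: "g \<in> F"
    using f by (simp add: g_def op_mem[OF G_op] blocks_mem)
  have eq: "cscale lam g = block S A M V U f + block S A M V V g"
    using resolvent_right[OF lam_resolvent blocks_mem(3)[OF f]] by (simp add: g_def algebra_simps)
  \<comment> \<open>The support of \<open>g\<close> is read off from the resolvent equation:
    \<open>lam\<close> times \<open>g\<close> is a sum of blocks with left index \<open>V\<close>,
    and \<open>lam\<close> is nonzero.\<close>
  have "cscale lam (cV * g) = cV * cscale lam g"
    by (simp add: mult_cscale)
  also have "\<dots> = cscale lam g"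
    by (simp add: eq distrib_left)
  finally show supp: "cV * g = g"
    using lam_nonzero by simp
  have add: "block S A M U1 U (cU * f + g) = block S A M U1 U f"
       "block S A M U1 V (cU * f + g) = block S A M U1 V g" if "U1 \<subseteq> S" for U1
    using op_add[OF block_op[OF M that U] chiU_mem[OF f] g] op_add[OF block_op[OF M that V] chiU_mem[OF f] g]
      block_chi_disjoint[OF disjoint, of U1 g] block_chi_disjoint[OF disjoint', of U1 f]
    by (simp_all add: supp)
  show "T (cU * f + g) = P f + cscale lam g"
    using f g by (simp add: T_eq chiU_mem add U V eq perron_complement_def flip: g_def)
qed

text \<open>Links the nondegeneracy hypothesis to \<open>\<nu> (T (cU * h))\<close>, hence to
  \<open>lam * \<nu> (cU * h)\<close>.\<close>

lemma block_Un_chiU: "T (cU * f) = block S A M (U \<union> V) U f"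
proof -
  have "chi S A (U \<union> V) * (cU * f) = cU * f"
    by (simp add: chi_Un[OF disjoint] distrib_right chi_disjoint[OF disjoint'])
  then show ?thesis by (simp add: block_def)
qed

section \<open>Transfer of the spectral gap from \<open>T\<close> to \<open>P\<close>\<close>

lemma spectral_gap_at_perron_complement:
  assumes R: "R \<in> bounded_ops F N"
    and decomp: "\<And>f. f \<in> F \<Longrightarrow> T f = cscale lam (rank_one h \<nu> f) + R f"
    and h: "eigenvector F T lam h"
    and \<nu>: "dual_eigenvector F N T lam \<nu>" and \<nu>h: "\<nu> h = 1"
    and lam_R: "lam \<in> resolvent_set F N R"
    and nondeg: "\<nu> (block S A M (U \<union> V) U h) \<noteq> 0"
  shows "spectral_gap_at F N P lam"
proof -
  have hF: "h \<in> F" and Th: "T h = cscale lam h"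
    using h by (auto simp: eigenvector_def)
  have \<nu>_dual: "\<nu> \<in> dual_space F N"
    using \<nu> by (simp add: dual_eigenvector_def)
  have \<nu>T: "\<nu> (T f) = lam * \<nu> f" if "f \<in> F" for f
    using \<nu> that by (simp add: dual_eigenvector_def)
  have "\<nu> (T (cU * h)) = lam * \<nu> (cU * h)"
    by (rule \<nu>T[OF chiU_mem[OF hF]])
  then have nz: "\<nu> (cU * h) \<noteq> 0"
    using nondeg by (auto simp: block_Un_chiU)
  define k where "k = cU * h"
  define \<phi> where "\<phi> f = \<nu> (cU * f) / \<nu> (cU * h)" for f
  have kF: "k \<in> F"
    by (simp add: k_def chiU_mem[OF hF])
  have chiU_k: "cU * k = k"
    by (simp add: k_def)
  have \<phi>: "\<phi> \<in> dual_space F N"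
    unfolding \<phi>_def[abs_def] by (rule dual_compose[OF \<nu>_dual chi_op[OF U]])
  have \<phi>k: "\<phi> k = 1"
    using nz by (simp add: \<phi>_def k_def)
  have Pk: "P k = cscale lam k"
    using perron_restrict[OF hF mem_zero] by (simp add: Th k_def)
  have \<phi>P: "\<phi> (P f) = lam * \<phi> f" if f: "f \<in> F" for f
  proof -
    obtain g where g: "g \<in> F" "T (cU * f + g) = P f + cscale lam g"
      using perron_lift[OF f] by blast
    \<comment> \<open>Both sides contain \<open>lam * \<nu> g\<close>, which cancels.\<close>
    have "\<nu> (P f + cscale lam g) = lam * \<nu> (cU * f + g)"
      using \<nu>T[of "cU * f + g"] chiU_mem[OF f] g by simp
    then have "\<nu> (P f) = lam * \<nu> (cU * f)"
      using f g(1) by (simp add: dual_add[OF \<nu>_dual] dual_cscale[OF \<nu>_dual] op_mem[OF P_op] chiU_mem distrib_left)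
    then show ?thesis
      by (simp add: \<phi>_def)
  qed
  define B where "B = resolvent F R lam"
  have B: "B \<in> bounded_ops F N"
    unfolding B_def by (rule resolvent_op[OF lam_R])
  have \<nu>R: "\<nu> (R f) = 0" if f: "f \<in> F" for f
    using \<nu>T[OF f] f by (simp add: decomp rank_one_def dual_add[OF \<nu>_dual] dual_cscale[OF \<nu>_dual]
        op_mem[OF R] hF \<nu>h)
  have Rh: "R h = 0"
    using decomp[OF hF] by (simp add: rank_one_def \<nu>h Th)
  \<comment> \<open>As \<open>R h = 0\<close>, the injective map \<open>lam - R\<close> takes
    \<open>f\<close> and \<open>\<nu> f\<close> times \<open>h\<close> to the same vector.\<close>
  have kerT: "f = cscale (\<nu> f) h" if f: "f \<in> F" and Tf: "T f = cscale lam f" for f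
  proof -
    have "cscale lam f - R f = cscale (\<nu> f) (cscale lam h - R h)"
      using decomp[OF f] Tf unfolding Rh by (simp add: rank_one_def algebra_simps mult.commute)
    then have "B (cscale lam f - R f) = cscale (\<nu> f) (B (cscale lam h - R h))"
      using hF by (simp add: op_cscale[OF B] op_mem[OF R])
    then show ?thesis
      unfolding B_def using resolvent_left[OF lam_R] f hF by simp
  qed
  \<comment> \<open>An eigenvector of \<open>P\<close> lifts to one of \<open>T\<close>, hence to a
    multiple of \<open>h\<close>; cutting down to \<open>U\<close> gives a multiple of
    \<open>k\<close>, and \<open>\<phi> k = 1\<close> fixes the coefficient.\<close>
  have kerP: "f = cscale (\<phi> f) k" if f: "f \<in> F" and Pf: "P f = cscale lam f" for f
  proof -
    have "cscale lam (cU * f) = cscale lam f"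
      using chiU_P[of f] unfolding Pf by (simp add: mult_cscale)
    then have Uf: "cU * f = f"
      using lam_nonzero by simp
    obtain g where g: "g \<in> F" "cV * g = g" "T (cU * f + g) = P f + cscale lam g"
      using perron_lift[OF f] by blast
    have "f + g = cscale (\<nu> (f + g)) h"
      using f g Pf Uf by (intro kerT) (simp_all add: cfun.scale_right_distrib)
    then have "cU * (f + g) = cU * cscale (\<nu> (f + g)) h"
      by simp
    moreover have "cU * g = 0"
      using chi_disjoint[OF disjoint, of S A g] g(2) by simp
    ultimately have "f = cscale (\<nu> (f + g)) k"
      by (simp add: distrib_left Uf mult_cscale k_def)
    then show ?thesis
      using dual_cscale[OF \<phi> kF, of "\<nu> (f + g)"] by (simp add: \<phi>k)
  qed
  define Q where "Q f = P f - cscale lam (rank_one k \<phi> f)" for f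
  have Q: "Q \<in> bounded_ops F N"
    unfolding Q_def
    by (intro bounded_ops_diff bounded_ops_compose[OF bounded_ops_cscale] bounded_ops_rank_one P_op \<phi> kF)
  have Qk: "Q k = 0"
    by (simp add: Q_def rank_one_def \<phi>k Pk)
  \<comment> \<open>\<open>lam - Q\<close> is multiplication by \<open>lam\<close> off \<open>U\<close> and on \<open>k\<close>. The remaining part \<open>s u\<close> of \<open>u\<close> is supported
    on \<open>U\<close> and killed by \<open>\<nu>\<close>, so \<open>w u\<close> solves \<open>(lam - T) (w u) = s u\<close>; subtracting the component
    of \<open>w u\<close> along \<open>k\<close> turns \<open>P\<close> into \<open>Q\<close>.\<close>
  define s where "s u = cU * u - rank_one k \<phi> u" for u
  define w where "w u = B (s u)" for u
  define E where "E u = cscale (1 / lam) (u - cU * u + rank_one k \<phi> u) + (cU * w u - rank_one k \<phi> (w u))" for u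
  have rank1: "rank_one k \<phi> \<in> bounded_ops F N"
    by (rule bounded_ops_rank_one[OF \<phi> kF])
  have s: "s \<in> bounded_ops F N"
    unfolding s_def[abs_def] by (rule bounded_ops_diff[OF chi_op[OF U] rank1])
  have w: "w \<in> bounded_ops F N"
    unfolding w_def[abs_def] by (rule bounded_ops_compose[OF B s])
  have E: "E \<in> bounded_ops F N"
    unfolding E_def[abs_def]
    by (rule bounded_ops_add[OF bounded_ops_compose[OF bounded_ops_cscale
          bounded_ops_add[OF bounded_ops_diff[OF bounded_ops_id chi_op[OF U]] rank1]]
        bounded_ops_diff[OF bounded_ops_compose[OF chi_op[OF U] w] bounded_ops_compose[OF rank1 w]]])
  have "lam \<in> resolvent_set F N Q"
  proof (rule bounded_right_inverse_imp_resolvent_set[OF Q E])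
    fix u assume u: "u \<in> F"
    have su: "s u \<in> F" "cU * s u = s u" and wu: "w u \<in> F"
      using op_mem[OF s u] op_mem[OF w u]
      by (simp_all add: s_def rank_one_def right_diff_distrib mult_cscale chiU_k)
    have "\<nu> (s u) = 0"
      using u kF nz by (simp add: s_def rank_one_def dual_diff[OF \<nu>_dual] dual_cscale[OF \<nu>_dual] chiU_mem \<phi>_def flip: k_def)
    moreover have wR: "cscale lam (w u) - R (w u) = s u"
      unfolding w_def B_def by (rule resolvent_right[OF lam_R su(1)])
    ultimately have "\<nu> (cscale lam (w u) - R (w u)) = 0"
      by simp
    \<comment> \<open>The rank-one part of \<open>T\<close> therefore vanishes at
      \<open>w u\<close>, so \<open>lam - R\<close> may be replaced by \<open>lam - T\<close>
      there.\<close>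
    then have "\<nu> (w u) = 0"
      using wu lam_nonzero by (simp add: dual_diff[OF \<nu>_dual] dual_cscale[OF \<nu>_dual] op_mem[OF R] \<nu>R)
    then have "cscale lam (w u) - T (w u) = s u"
      using wR by (simp add: decomp[OF wu] rank_one_def)
    then have Pw: "P (w u) = cscale lam (cU * w u) - s u"
      by (rule perron_restrict[OF wu su])
    have Q_chiU: "Q (cU * f) = Q f" for f
      by (simp add: Q_def rank_one_def \<phi>_def)
    have Q_rank1: "Q (rank_one k \<phi> f) = 0" for f
      by (simp add: rank_one_def op_cscale[OF Q kF] Qk)
    have rank1_mem: "rank_one k \<phi> f \<in> F" for f
      by (simp add: rank_one_def kF)
    define a where "a = u - cU * u + rank_one k \<phi> u"
    define b where "b = cU * w u - rank_one k \<phi> (w u)"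
    have a: "a \<in> F" and b: "b \<in> F"
      using u wu by (simp_all add: a_def b_def chiU_mem rank1_mem)
    have Qa: "Q a = 0"
      using u by (simp add: a_def op_add[OF Q] op_diff[OF Q] chiU_mem rank1_mem Q_chiU Q_rank1)
    have "Q b = Q (w u)"
      using wu by (simp add: b_def op_diff[OF Q] chiU_mem rank1_mem Q_chiU Q_rank1)
    \<comment> \<open>The multiple of \<open>k\<close> subtracted in \<open>b\<close> matches
      exactly the rank-one term by which \<open>Q\<close> differs from \<open>P\<close>.\<close>
    also have "\<dots> = cscale lam b - s u"
      by (simp add: Q_def Pw b_def cfun.scale_right_diff_distrib)
    finally have Qb: "Q b = cscale lam b - s u" .
    have Eu: "E u = cscale (1 / lam) a + b"
      by (simp add: E_def a_def b_def)
    have "Q (E u) = cscale lam b - s u"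
      unfolding Eu using a b by (simp add: op_add[OF Q] op_cscale[OF Q] Qa Qb)
    moreover have "cscale lam (E u) = a + cscale lam b"
      using lam_nonzero by (simp add: Eu cfun.scale_right_distrib)
    moreover have "a + s u = u"
      by (simp add: a_def s_def)
    ultimately show "cscale lam (E u) - Q (E u) = u"
      by simp
  next
    fix f assume f: "f \<in> F" and Qf: "Q f = cscale lam f"
    \<comment> \<open>\<open>\<phi>\<close> annihilates the range of \<open>Q\<close>, so an
      eigenvector for \<open>lam\<close> has \<open>\<phi> f = 0\<close>; there \<open>Q\<close>
      coincides with \<open>P\<close> and \<open>kerP\<close> applies.\<close>
    have "\<phi> (Q f) = 0"
      using f by (simp add: Q_def rank_one_def dual_diff[OF \<phi>] dual_cscale[OF \<phi>] op_mem[OF P_op] \<phi>P \<phi>k kF)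
    then have "\<phi> f = 0"
      unfolding Qf dual_cscale[OF \<phi> f] using lam_nonzero by simp
    then have "P f = cscale lam f"
      using Qf by (simp add: Q_def rank_one_def)
    then show "f = 0"
      using kerP[OF f] \<open>\<phi> f = 0\<close> by simp
  qed
  then have res: "lam \<in> resolvent_set F N (\<lambda>f. P f - cscale lam (rank_one k \<phi> f))"
    by (simp add: Q_def[abs_def])
  have "k \<noteq> 0"
    using dual_cscale[OF \<phi> kF, of 0] \<phi>k by auto
  then have eig: "eigenvector F P lam k"
    by (simp add: eigenvector_def kF Pk)
  show ?thesis
    by (rule spectral_gap_at_if_deflation[OF P_op eig lam_nonzero \<phi> \<phi>k \<phi>P res])
qed

end

theorem theorem2p7:
  fixes S :: "'s set" and A :: "'s \<Rightarrow> 's \<Rightarrow> nat"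
    and F :: "((nat \<Rightarrow> 's) \<Rightarrow> complex) set" and N :: "((nat \<Rightarrow> 's) \<Rightarrow> complex) \<Rightarrow> real"
    and M R :: "((nat \<Rightarrow> 's) \<Rightarrow> complex) \<Rightarrow> ((nat \<Rightarrow> 's) \<Rightarrow> complex)"
    and U V W :: "'s set" and lam :: complex
    and h :: "(nat \<Rightarrow> 's) \<Rightarrow> complex" and \<nu> :: "((nat \<Rightarrow> 's) \<Rightarrow> complex) \<Rightarrow> complex"
  assumes "shift_function_space S A F N"
    and "M \<in> bounded_ops F N"
    and "U \<subseteq> S" and "V \<subseteq> S" and "U \<noteq> {}" and "U \<inter> V = {}"
    and "lam \<noteq> 0" and "lam \<in> resolvent_set F N (block S A M V V)"
    and "W = U \<union> V"
    and "R \<in> bounded_ops F N"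
    and "\<forall>f\<in>F. block S A M W W f = cscale lam (rank_one h \<nu> f) + R f"
    and "simple_eigenvalue F (block S A M W W) lam"
    and "eigenvector F (block S A M W W) lam h"
    and "dual_eigenvector F N (block S A M W W) lam \<nu>"
    and "\<nu> h = 1"
    and "\<exists>T. open T \<and> lam \<in> T \<and> T \<inter> spectrum F N R = {}"
    and "\<nu> (block S A M W U h) \<noteq> 0"
  shows "spectral_gap_at F N (perron_complement S A F M U V lam) lam"
proof -
  interpret shift_function_space S A F N by fact
  interpret perron_setting S A F N M U V lam
    by unfold_locales (use assms in auto)
  have "lam \<in> resolvent_set F N R"
    using assms(16) unfolding spectrum_def by blast
  then show ?thesis
    using assms by (intro spectral_gap_at_perron_complement[of R h \<nu>]) simp_all
qed

end
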